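(* Let $a,b,c$ be real numbers. There are real numbers $x,y,z$ such that $$a=x+y+z,\quad b=xy+yz+zx\quad\text{and}\quad c=xyz$$ if and only if $$4\left(b-\frac{a^2}{3}\right)^3+27\left(c-\frac{ab}{3}+\frac{2a^3}{27}\right)^2\le 0.$$ *)

theory Defs
  imports Complex_Main
begin

end

(* The expression on the right is minus the discriminant
   ((x - y) (y - z) (z - x))^2 of t^3 - a t^2 + b t - c.
   Conversely, this cubic has a real root x. Dividing by t - x leaves a real quadratic q with
   discriminant D, and the discriminant of the cubic is D q(x)^2. If q(x) is nonzero, then D is
   nonnegative by hypothesis; otherwise q has the real root x. Either way q splits over the reals. *)
theory Submission
  imports Defs
begin

text \<open>The intermediate value theorem applies on \<open>{- M..M}\<close> once \<open>M\<close>
  is so large that the cubic term dominates at both ends.\<close>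

lemma cubic_real_root:
  fixes a b c :: real
  shows "\<exists>t. t ^ 3 - a * t ^ 2 + b * t - c = 0"
proof -
  define f where "f = (\<lambda>t. t ^ 3 - a * t ^ 2 + b * t - c)"
  \<comment> \<open>The summand 1 gives \<open>M \<ge> 1\<close>, so each lower-order term is at
    most its coefficient's absolute value times \<open>M ^ 2\<close>; these absolute values add up
    to \<open>M - 1\<close>.\<close>
  define M where "M = 1 + \<bar>a\<bar> + \<bar>b\<bar> + \<bar>c\<bar>"
  have M: "1 \<le> M" by (simp add: M_def)
  then have M2: "M \<le> M ^ 2" "1 \<le> M ^ 2"
    by (auto simp: self_le_power)
  have "\<bar>a\<bar> * M ^ 2 + \<bar>b\<bar> * M + \<bar>c\<bar> \<le> \<bar>a\<bar> * M ^ 2 + \<bar>b\<bar> * M ^ 2 + \<bar>c\<bar> * M ^ 2"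
    using mult_left_mono[OF M2(1), of "\<bar>b\<bar>"] mult_left_mono[OF M2(2), of "\<bar>c\<bar>"] by simp
  also have "\<dots> = (M - 1) * M ^ 2"
    by (simp add: M_def algebra_simps)
  also have "\<dots> \<le> M ^ 3"
    by (simp add: algebra_simps power2_eq_square power3_eq_cube)
  finally have dom: "\<bar>a\<bar> * M ^ 2 + \<bar>b\<bar> * M + \<bar>c\<bar> \<le> M ^ 3" .
  have "\<bar>a * M ^ 2\<bar> = \<bar>a\<bar> * M ^ 2" "\<bar>b * M\<bar> = \<bar>b\<bar> * M"
    using M by (simp_all add: abs_mult)
  moreover have "f (- M) = - (M ^ 3) - a * M ^ 2 - b * M - c" "f M = M ^ 3 - a * M ^ 2 + b * M - c"
    by (simp_all add: f_def)
  ultimately have "f (- M) \<le> 0" "0 \<le> f M"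
    using dom by linarith+
  moreover have "continuous_on {- M..M} f"
    unfolding f_def by (intro continuous_intros)
  ultimately obtain t where "f t = 0"
    using IVT'[of f "- M" 0 M] M by auto
  then show ?thesis by (auto simp: f_def)
qed

lemma real_pair_from_sum_and_product:
  fixes u v :: real
  assumes "0 \<le> u ^ 2 - 4 * v"
  shows "\<exists>y z. y + z = u \<and> y * z = v"
proof (intro exI conjI)
  let ?r = "sqrt (u ^ 2 - 4 * v)"
  \<comment> \<open>This fixes the schematic witnesses left by \<open>exI\<close>: the roots of t^2
    - u t + v from the quadratic formula.\<close>
  show "(u + ?r) / 2 + (u - ?r) / 2 = u" by (simp add: field_simps)
  have "(u + ?r) * (u - ?r) = u ^ 2 - ?r ^ 2"
    by (simp add: algebra_simps power2_eq_square del: real_sqrt_mult_self)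
  then show "(u + ?r) / 2 * ((u - ?r) / 2) = v" using assms by simp
qed

text \<open>The assumptions encode t^3 - a t^2 + b t - c = (t - x)(t^2 - u t + v). If y, z are the
  complex roots of the quadratic factor, then (y - z)^2 = u^2 - 4v and (x - y)(x - z) = x^2 - u x +
  v.\<close>

lemma cubic_discriminant:
  fixes x u v :: real
  assumes "a = x + u" "b = x * u + v" "c = x * v"
  shows "4 * (b - a ^ 2 / 3) ^ 3 + 27 * (c - a * b / 3 + 2 * a ^ 3 / 27) ^ 2
    = - ((u ^ 2 - 4 * v) * (x ^ 2 - u * x + v) ^ 2)"
  unfolding assms by (simp add: field_simps power2_eq_square power3_eq_cube)

theorem theorem1:
  fixes a b c :: real
  shows "(\<exists>x y z :: real. a = x + y + z \<and> b = x * y + y * z + z * x \<and> c = x * y * z)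
    \<longleftrightarrow> 4 * (b - a^2 / 3) ^ 3 + 27 * (c - a * b / 3 + 2 * a ^ 3 / 27) ^ 2 \<le> 0"
    (is "?L \<longleftrightarrow> ?R")
proof
  assume ?L
  then obtain x y z where "a = x + y + z" "b = x * y + y * z + z * x" "c = x * y * z"
    by blast
  then have "a = x + (y + z)" "b = x * (y + z) + y * z" "c = x * (y * z)"
    by (simp_all add: algebra_simps)
  note cubic_discriminant[OF this]
  moreover have "(y + z) ^ 2 - 4 * (y * z) = (y - z) ^ 2"
    by (simp add: algebra_simps power2_eq_square)
  ultimately show ?R by simp
next
  assume R: ?R
  obtain x where x: "x ^ 3 - a * x ^ 2 + b * x - c = 0"
    using cubic_real_root by blast
  \<comment> \<open>Coefficients of the quotient t^2 - u t + v; that \<open>x\<close> is a root is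
    what gives \<open>c = x * v\<close>.\<close>
  define u where "u = a - x"
  define v where "v = b - x * u"
  have abc: "a = x + u" "b = x * u + v" "c = x * v"
    using x by (simp_all add: u_def v_def algebra_simps power2_eq_square power3_eq_cube)
  have "0 \<le> u ^ 2 - 4 * v"
  proof (cases "x ^ 2 - u * x + v = 0")
    case True
    \<comment> \<open>In general (2x - u)^2 = 4(x^2 - u x + v) + (u^2 - 4v).\<close>
    then have "u ^ 2 - 4 * v = (2 * x - u) ^ 2"
      by (simp add: algebra_simps power2_eq_square)
    then show ?thesis by simp
  next
    case False
    then have "0 < (x ^ 2 - u * x + v) ^ 2" by simp
    moreover have "0 \<le> (u ^ 2 - 4 * v) * (x ^ 2 - u * x + v) ^ 2"
      using R cubic_discriminant[OF abc] by simp
    ultimately show ?thesis by (simp only: zero_le_mult_iff) linarith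
  qed
  then obtain y z where "y + z = u" "y * z = v"
    using real_pair_from_sum_and_product by blast
  with abc have "a = x + y + z" "b = x * y + y * z + z * x" "c = x * y * z"
    by (auto simp: algebra_simps)
  then show ?L by blast
qed

end
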